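(* Let $q\ge 2$ and $n\ge 1$ be integers and let $\mathcal{C}\subseteq \mathbb{F}_q^n$ be an LP universally optimal code. Then $\mathcal{C}$ is distance regular, and for every $c\in\mathcal{C}$ the code $\mathcal{C}\setminus\{c\}$ is universally optimal.
   Context: $\mathbb{F}_q$ denotes any alphabet with $q$ elements (no field structure is used) and $|x-y|$ is the Hamming distance between $x,y\in\mathbb{F}_q^n$. For a code $\mathcal{C}$ and $f\colon\{1,\dots,n\}\to\mathbb{R}$, the $f$-potential energy is $E_f(\mathcal{C})=\frac{1}{|\mathcal{C}|}\sum_{x,y\in\mathcal{C},\,x\ne y} f(|x-y|)$. With $\Delta f(m)=f(m+1)-f(m)$, a function $f$ on $\{a,a+1,\dots,b\}$ is completely monotonic if $(-1)^k\Delta^k f(i)\ge 0$ whenever $k\ge0$ and $a\le i\le b-k$. A code $\mathcal{C}\subseteq\mathbb{F}_q^n$ is universally optimal if $E_f(\mathcal{C})\le E_f(\mathcal{C}')$ for every $\mathcal{C}'\subseteq\mathbb{F}_q^n$ with $|\mathcal{C}'|=|\mathcal{C}|$ and every completely monotonic $f\colon\{1,\dots,n\}\to\mathbb{R}$. The Krawtchouk polynomials are $K_k(x)=\sum_{j=0}^k(-1)^j(q-1)^{k-j}\binom{x}{j}\binom{n-x}{k-j}$. The distance distribution of $\mathcal{C}$ is $A_i=\frac{1}{|\mathcal{C}|}|\{(x,y)\in\mathcal{C}^2:|x-y|=i\}|$, $i=0,\dots,n$. A quasicode of size $N$ is a real vector $(A_0,\dots,A_n)$ with $A_0=1$, $A_i\ge0$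 for all $i$, $\sum_i A_i=N$, and $\sum_{i=0}^n A_iK_j(i)\ge0$ for $j=1,\dots,n$. A code $\mathcal{C}$ is LP universally optimal if for every completely monotonic $f\colon\{1,\dots,n\}\to\mathbb{R}$ its distance distribution minimizes $\sum_{i=1}^n A_if(i)$ over all quasicodes $(A_0,\dots,A_n)$ of size $|\mathcal{C}|$. A code is distance regular if for each $i$, every codeword has the same number of codewords at distance $i$ from it. *)

theory Defs
  imports Complex_Main "HOL-Library.FuncSet"
begin

definition words :: "'a set \<Rightarrow> nat \<Rightarrow> (nat \<Rightarrow> 'a) set" where
  "words F n = {1..n} \<rightarrow>\<^sub>E F"

definition hamming_dist :: "nat \<Rightarrow> (nat \<Rightarrow> 'a) \<Rightarrow> (nat \<Rightarrow> 'a) \<Rightarrow> nat" where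
  "hamming_dist n x y = card {i \<in> {1..n}. x i \<noteq> y i}"

text \<open>For the empty code this is \<open>0 / 0 = 0\<close>.\<close>

definition energy :: "nat \<Rightarrow> (nat \<Rightarrow> real) \<Rightarrow> (nat \<Rightarrow> 'a) set \<Rightarrow> real" where
  "energy n f C =
     (\<Sum>(x, y) \<in> {(x, y). x \<in> C \<and> y \<in> C \<and> x \<noteq> y}. f (hamming_dist n x y)) / real (card C)"

definition fwd_diff :: "(nat \<Rightarrow> real) \<Rightarrow> nat \<Rightarrow> real" where
  "fwd_diff f m = f (m + 1) - f m"

text \<open>The condition \<open>i + k \<le> b\<close> (rather than a truncated subtraction) ensures that only values of
  \<open>f\<close> on \<open>{a..b}\<close> are used.\<close>

definition completely_monotonic :: "nat \<Rightarrow> nat \<Rightarrow> (nat \<Rightarrow> real) \<Rightarrow> bool" where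
  "completely_monotonic a b f \<longleftrightarrow>
     (\<forall>k i. a \<le> i \<and> i + k \<le> b \<longrightarrow> (- 1) ^ k * (fwd_diff ^^ k) f i \<ge> 0)"

definition universally_optimal :: "'a set \<Rightarrow> nat \<Rightarrow> (nat \<Rightarrow> 'a) set \<Rightarrow> bool" where
  "universally_optimal F n C \<longleftrightarrow>
     (\<forall>f C'. completely_monotonic 1 n f \<and> C' \<subseteq> words F n \<and> card C' = card C
        \<longrightarrow> energy n f C \<le> energy n f C')"

definition krawtchouk :: "nat \<Rightarrow> nat \<Rightarrow> nat \<Rightarrow> real \<Rightarrow> real" where
  "krawtchouk q n k x =
     (\<Sum>j = 0..k. (- 1) ^ j * (real q - 1) ^ (k - j) * (x gchoose j) * ((real n - x) gchoose (k - j)))"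

definition distance_distribution :: "nat \<Rightarrow> (nat \<Rightarrow> 'a) set \<Rightarrow> nat \<Rightarrow> real" where
  "distance_distribution n C i =
     real (card {(x, y). x \<in> C \<and> y \<in> C \<and> hamming_dist n x y = i}) / real (card C)"

text \<open>A vector \<open>(A\<^sub>0, \<dots>, A\<^sub>n)\<close> is represented by a function on the naturals of which only the
  values on \<open>{0..n}\<close> matter.\<close>

definition quasicode :: "nat \<Rightarrow> nat \<Rightarrow> real \<Rightarrow> (nat \<Rightarrow> real) \<Rightarrow> bool" where
  "quasicode q n N A \<longleftrightarrow>
     A 0 = 1 \<and> (\<forall>i\<in>{0..n}. A i \<ge> 0) \<and> (\<Sum>i = 0..n. A i) = N \<and>
     (\<forall>j\<in>{1..n}. (\<Sum>i = 0..n. A i * krawtchouk q n j (real i)) \<ge> 0)"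

text \<open>The distance distribution of a nonempty code is itself a quasicode by the Delsarte
  inequalities, so this is not imposed as a separate condition.\<close>

definition lp_universally_optimal :: "nat \<Rightarrow> nat \<Rightarrow> (nat \<Rightarrow> 'a) set \<Rightarrow> bool" where
  "lp_universally_optimal q n C \<longleftrightarrow>
     (\<forall>f A. completely_monotonic 1 n f \<and> quasicode q n (real (card C)) A
        \<longrightarrow> (\<Sum>i = 1..n. distance_distribution n C i * f i) \<le> (\<Sum>i = 1..n. A i * f i))"

definition distance_regular :: "nat \<Rightarrow> (nat \<Rightarrow> 'a) set \<Rightarrow> bool" where
  "distance_regular n C \<longleftrightarrow>
     (\<forall>i. \<forall>x\<in>C. \<forall>y\<in>C.
        card {z \<in> C. hamming_dist n x z = i} = card {z \<in> C. hamming_dist n y z = i})"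

end

theory Submission
  imports Defs
begin

text \<open>
  Optimality of \<open>C\<close>, with \<open>N = |C|\<close>, is only ever tested against three kinds of quasicodes, obtained
  by perturbing its distance distribution \<open>A\<close>. Write \<open>K\<^sub>j(|x - y|)\<close> as the sum over \<open>j\<close>-sets \<open>S\<close> of
  coordinates of the positive semidefinite kernels \<open>\<Prod>i\<in>S. (q [x i = y i] - 1)\<close>.

  Moving from \<open>A\<close> towards the distance distribution seen from a single codeword \<open>c\<close> stays feasible for a
  short time: where a Delsarte inequality is tight, semidefiniteness makes it tight for \<open>c\<close> as well. Hence
  no codeword has energy below the average, so all have the same energy for every completely monotonic
  potential. The potentials \<open>m \<mapsto> (n - m choose k)\<close> are completely monotonic and span, which gives distance
  regularity.

  Each kernel form is at least \<open>(q - 1)^|S|\<close> on a code whose size is not divisible by \<open>q\<close>. If \<open>q\<close> divides \<open>N\<close>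
  and \<open>|C'| = N - 1\<close>, this says precisely that the numbers of ordered pairs of \<open>C'\<close> at distance \<open>i \<ge> 1\<close>,
  divided by \<open>N - 2\<close>, form a quasicode of size \<open>N\<close>; comparing it with \<open>A\<close> is the claim. If \<open>q\<close> does not
  divide \<open>N\<close>, all Delsarte inequalities for \<open>C\<close> are strict, so one may perturb towards having all distances
  equal to \<open>n\<close>, where every completely monotonic potential is least.
\<close>

section \<open>Kernels on sets of coordinates and their quadratic forms\<close>

definition letter_kernel :: "nat \<Rightarrow> nat set \<Rightarrow> (nat \<Rightarrow> 'a) \<Rightarrow> (nat \<Rightarrow> 'a) \<Rightarrow> real" where
  "letter_kernel q S x y = (\<Prod>i\<in>S. if x i = y i then real q - 1 else - 1)"

text \<open>Up to the factor 2, this writes the one-coordinate kernel as a Gram matrix whose vectors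
  have integer entries. The Gram form yields nonnegativity, the integrality a quantitative lower
  bound.\<close>

lemma sum_letter_differences:
  fixes u v :: 'a
  assumes "finite F" "card F = q" "u \<in> F" "v \<in> F"
  shows "(\<Sum>a\<in>F. \<Sum>b\<in>F. (of_bool (u = a) - of_bool (u = b)) * (of_bool (v = a) - of_bool (v = b)))
         = 2 * (if u = v then real q - 1 else - 1)"
proof -
  have delta: "(\<Sum>a\<in>F. of_bool (w = a) :: real) = 1" if "w \<in> F" for w
    using assms(1) that by simp
  have delta2: "(\<Sum>a\<in>F. of_bool (u = a) * of_bool (v = a) :: real) = of_bool (u = v)"
  proof -
    have "(\<Sum>a\<in>F. of_bool (u = a) * of_bool (v = a) :: real) = (\<Sum>a\<in>F. of_bool (u = a) * of_bool (u = v))"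
      by (rule sum.cong) auto
    also have "\<dots> = of_bool (u = v)"
      unfolding sum_distrib_right[symmetric] using delta assms by simp
    finally show ?thesis .
  qed
  have "(\<Sum>a\<in>F. \<Sum>b\<in>F. (of_bool (u = a) - of_bool (u = b)) * (of_bool (v = a) - of_bool (v = b)) :: real)
      = (\<Sum>a\<in>F. \<Sum>b\<in>F. of_bool (u = a) * of_bool (v = a) + of_bool (u = b) * of_bool (v = b)
          - of_bool (u = a) * of_bool (v = b) - of_bool (v = a) * of_bool (u = b))"
    by (intro sum.cong refl) (simp only: algebra_simps)
  also have "\<dots> = 2 * real q * of_bool (u = v) - 2"
    using assms
    by (simp add: sum.distrib sum_subtractf delta delta2 flip: sum_distrib_left sum_distrib_right del: sum_of_bool_mult_eq sum_mult_of_bool_eq of_bool_eq_iff)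
  finally show ?thesis by simp
qed

text \<open>Arbitrary weights \<open>g\<close> are allowed because removing a coordinate from
  \<open>S\<close> turns its kernel factor into new weights.\<close>

definition letter_form :: "nat \<Rightarrow> nat set \<Rightarrow> (nat \<Rightarrow> 'a) set \<Rightarrow> ((nat \<Rightarrow> 'a) \<Rightarrow> real) \<Rightarrow> real" where
  "letter_form q S D g = (\<Sum>x\<in>D. \<Sum>y\<in>D. g x * g y * letter_kernel q S x y)"

text \<open>Expanding the factor at \<open>i\<close> by \<open>sum_letter_differences\<close>
  separates its dependence on \<open>x\<close> and \<open>y\<close>, and each part is absorbed into
  the weight of its word. This recursion drives both inductions over \<open>S\<close>.\<close>

lemma letter_form_insert:
  assumes "finite F" "card F = q" "finite S" "i \<notin> S" "\<And>x. x \<in> D \<Longrightarrow> x i \<in> F"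
  shows "letter_form q (insert i S) D g
       = (\<Sum>a\<in>F. \<Sum>b\<in>F. letter_form q S D (\<lambda>x. g x * (of_bool (x i = a) - of_bool (x i = b)))) / 2"
proof -
  let ?d = "\<lambda>x a b. of_bool (x i = a) - of_bool (x i = b) :: real"
  have "(\<Sum>a\<in>F. \<Sum>b\<in>F. letter_form q S D (\<lambda>x. g x * ?d x a b))
      = (\<Sum>a\<in>F. \<Sum>x\<in>D. \<Sum>b\<in>F. \<Sum>y\<in>D. g x * ?d x a b * (g y * ?d y a b) * letter_kernel q S x y)"
    unfolding letter_form_def by (intro sum.cong refl sum.swap)
  also have "\<dots> = (\<Sum>x\<in>D. \<Sum>a\<in>F. \<Sum>y\<in>D. \<Sum>b\<in>F. g x * ?d x a b * (g y * ?d y a b) * letter_kernel q S x y)"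
    by (subst sum.swap) (intro sum.cong refl sum.swap)
  also have "\<dots> = (\<Sum>x\<in>D. \<Sum>y\<in>D. \<Sum>a\<in>F. \<Sum>b\<in>F. g x * ?d x a b * (g y * ?d y a b) * letter_kernel q S x y)"
    by (intro sum.cong refl sum.swap)
  also have "\<dots> = (\<Sum>x\<in>D. \<Sum>y\<in>D. g x * g y * letter_kernel q S x y * (\<Sum>a\<in>F. \<Sum>b\<in>F. ?d x a b * ?d y a b))"
    unfolding sum_distrib_left by (intro sum.cong refl) (simp only: mult_ac)
  also have "\<dots> = (\<Sum>x\<in>D. \<Sum>y\<in>D. 2 * (g x * g y * letter_kernel q (insert i S) x y))"
    using assms by (intro sum.cong refl, subst sum_letter_differences) (auto simp: letter_kernel_def)
  also have "\<dots> = 2 * letter_form q (insert i S) D g"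
    by (simp add: letter_form_def sum_distrib_left)
  finally show ?thesis by simp
qed

lemma letter_form_empty: "letter_form q {} D g = (\<Sum>x\<in>D. g x)\<^sup>2"
  by (simp add: letter_form_def letter_kernel_def power2_eq_square sum_product)

lemma letter_form_nonneg:
  assumes "finite F" "card F = q" "finite S" "\<And>x i. x \<in> D \<Longrightarrow> i \<in> S \<Longrightarrow> x i \<in> F"
  shows "0 \<le> letter_form q S D g"
  using assms(3,4)
proof (induction S arbitrary: g rule: finite_induct)
  case empty
  then show ?case by (simp add: letter_form_empty)
next
  case (insert i S)
  have "letter_form q (insert i S) D g
       = (\<Sum>a\<in>F. \<Sum>b\<in>F. letter_form q S D (\<lambda>x. g x * (of_bool (x i = a) - of_bool (x i = b)))) / 2"
    using insert assms by (intro letter_form_insert) auto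
  also have "\<dots> \<ge> 0"
    using insert by (intro divide_nonneg_nonneg sum_nonneg) auto
  finally show ?case .
qed

section \<open>Lower bound when \<open>q\<close> does not divide the total weight\<close>

text \<open>If all \<open>m a\<close> were congruent, their sum would be \<open>card F\<close> times
  one of them modulo \<open>card F\<close>, hence divisible. So the class \<open>G\<close> of some
  letter is neither empty nor all of \<open>F\<close>, and every pair separated by \<open>G\<close>,
  in either order, is incongruent.\<close>

lemma card_incongruent_pairs:
  fixes m :: "'a \<Rightarrow> int"
  assumes "finite F" "\<not> int (card F) dvd (\<Sum>a\<in>F. m a)"
  shows "2 * (card F - 1) \<le> card {(a, b) \<in> F \<times> F. \<not> int (card F) dvd m a - m b}"
proof -
  let ?q = "card F"
  have "F \<noteq> {}" using assms by auto
  then obtain c where c: "c \<in> F" by auto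
  define G where "G = {a \<in> F. int ?q dvd m a - m c}"
  have fin: "finite G" "finite (F - G)" and "G \<subseteq> F" using assms by (auto simp: G_def)
  have "F \<noteq> G"
  proof
    assume "F = G"
    then have "int ?q dvd (\<Sum>a\<in>F. m a - m c)"
      by (intro dvd_sum) (auto simp: G_def)
    then have "int ?q dvd (\<Sum>a\<in>F. m a) - int ?q * m c"
      by (simp add: sum_subtractf)
    then have "int ?q dvd (\<Sum>a\<in>F. m a)"
      by (metis dvd_diffD1 dvd_triv_left dvd_diff_right_iff dvd_refl diff_add_cancel dvd_add dvd_mult2)
    with assms show False by simp
  qed
  then have "card G < ?q" using \<open>G \<subseteq> F\<close> assms by (intro psubset_card_mono) auto
  moreover have "0 < card G" using c fin by (auto simp: card_gt_0_iff G_def)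
  ultimately obtain k l where kl: "card G = Suc k" "?q = Suc k + Suc l"
    by (metis Suc_pred less_iff_Suc_add add_Suc_right)
  have "card (F - G) = Suc l"
    using kl \<open>G \<subseteq> F\<close> fin by (simp add: card_Diff_subset)
  \<comment> \<open>With \<open>k + 1\<close> letters inside \<open>G\<close> and
    \<open>l + 1\<close> outside, this is \<open>k + l + 1 \<le> (k + 1) * (l + 1)\<close>.\<close>
  then have "2 * (?q - 1) \<le> card (G \<times> (F - G)) + card ((F - G) \<times> G)"
    using kl by (simp add: card_cartesian_product)
  also have "\<dots> = card (G \<times> (F - G) \<union> (F - G) \<times> G)"
    using fin by (intro card_Un_disjoint[symmetric]) auto
  also have "\<dots> \<le> card {(a, b) \<in> F \<times> F. \<not> int ?q dvd m a - m b}"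
  proof (rule card_mono)
    show "finite {(a, b) \<in> F \<times> F. \<not> int ?q dvd m a - m b}"
      using assms by (auto intro: finite_subset[of _ "F \<times> F"])
    have "\<not> int ?q dvd m a - m b" "\<not> int ?q dvd m b - m a" if "a \<in> G" "b \<in> F - G" for a b
    proof -
      have 1: "int ?q dvd m a - m c" "\<not> int ?q dvd m b - m c" using that by (auto simp: G_def)
      have "m b - m c = (m a - m c) - (m a - m b)" by simp
      then show a: "\<not> int ?q dvd m a - m b" using 1 by (metis dvd_diff)
      then show "\<not> int ?q dvd m b - m a" by (metis dvd_minus_iff minus_diff_eq)
    qed
    then show "G \<times> (F - G) \<union> (F - G) \<times> G \<subseteq> {(a, b) \<in> F \<times> F. \<not> int ?q dvd m a - m b}"
      using \<open>G \<subseteq> F\<close> by auto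
  qed
  finally show ?thesis .
qed

text \<open>Integer weights matter in the base case: a nonzero integer has square at least 1. The
  application has all weights 1, but the induction leaves that case.\<close>

lemma letter_form_ge:
  fixes g :: "(nat \<Rightarrow> 'a) \<Rightarrow> int"
  assumes "finite F" "card F = q" "finite S" "\<And>x i. x \<in> D \<Longrightarrow> i \<in> S \<Longrightarrow> x i \<in> F"
    and "\<not> int q dvd (\<Sum>x\<in>D. g x)"
  shows "(real q - 1) ^ card S \<le> letter_form q S D (\<lambda>x. real_of_int (g x))"
  using assms(3,4,5)
proof (induction S arbitrary: g rule: finite_induct)
  case empty
  then have "(\<Sum>x\<in>D. g x) \<noteq> 0" by auto
  then have "1 \<le> (\<Sum>x\<in>D. g x)\<^sup>2"
    by (metis zero_less_power2 zless_imp_add1_zle add_0)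
  then have "1 \<le> (\<Sum>x\<in>D. real_of_int (g x))\<^sup>2"
    by (metis of_int_1_le_iff of_int_power of_int_sum)
  then show ?case by (simp add: letter_form_empty)
next
  case (insert i S)
  define m where "m a = (\<Sum>x\<in>D. g x * of_bool (x i = a))" for a
  define h where "h a b x = g x * (of_bool (x i = a) - of_bool (x i = b))" for a b x
  define P where "P = {(a, b) \<in> F \<times> F. \<not> int q dvd m a - m b}"
  \<comment> \<open>Slicing along coordinate \<open>i\<close> writes the form as half the sum of the forms of the differences of
    slices. The slice totals \<open>m a\<close> are not all congruent modulo \<open>q\<close>, so the induction hypothesis applies
    to at least \<open>2 (q - 1)\<close> of these differences.\<close>
  have sum_h: "(\<Sum>x\<in>D. h a b x) = m a - m b" for a b
    by (simp add: h_def m_def sum_subtractf algebra_simps)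
  have "(\<Sum>a\<in>F. m a) = (\<Sum>x\<in>D. g x * (\<Sum>a\<in>F. of_bool (x i = a)))"
    unfolding m_def sum_distrib_left by (rule sum.swap)
  also have "\<dots> = (\<Sum>x\<in>D. g x)"
    using insert.prems assms by (intro sum.cong) auto
  finally have sum_m: "(\<Sum>a\<in>F. m a) = (\<Sum>x\<in>D. g x)" .
  then have "\<not> int (card F) dvd (\<Sum>a\<in>F. m a)"
    using insert.prems assms by simp
  then have cardP: "2 * (q - 1) \<le> card P"
    using card_incongruent_pairs[OF assms(1), of m] assms(2) by (simp add: P_def)
  have "F \<noteq> {}" using \<open>\<not> int (card F) dvd (\<Sum>a\<in>F. m a)\<close> by auto
  then have "q \<noteq> 0" using assms by auto
  then have "2 * (real q - 1) = real (2 * (q - 1))" by simp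
  also have "\<dots> \<le> real (card P)" using cardP by (rule of_nat_mono)
  finally have cardP': "2 * (real q - 1) \<le> real (card P)" .
  have nonneg: "0 \<le> letter_form q S D f" for f
    using insert.prems insert.hyps assms by (intro letter_form_nonneg) auto
  have "2 * (real q - 1) ^ card (insert i S) = (2 * (real q - 1)) * (real q - 1) ^ card S"
    using insert.hyps by simp
  also have "\<dots> \<le> real (card P) * (real q - 1) ^ card S"
    using cardP' \<open>q \<noteq> 0\<close> by (intro mult_right_mono) auto
  also have "\<dots> = (\<Sum>p\<in>P. (real q - 1) ^ card S)" by simp
  also have "\<dots> \<le> (\<Sum>(a, b)\<in>P. letter_form q S D (\<lambda>x. real_of_int (h a b x)))"
  proof (intro sum_mono, clarify)
    fix a b assume "(a, b) \<in> P"
    then show "(real q - 1) ^ card S \<le> letter_form q S D (\<lambda>x. real_of_int (h a b x))"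
      using insert.prems by (intro insert.IH) (auto simp: P_def sum_h)
  qed
  also have "\<dots> \<le> (\<Sum>(a, b)\<in>F \<times> F. letter_form q S D (\<lambda>x. real_of_int (h a b x)))"
    using assms nonneg by (intro sum_mono2) (auto simp: P_def)
  also have "\<dots> = (\<Sum>a\<in>F. \<Sum>b\<in>F. letter_form q S D (\<lambda>x. real_of_int (g x) * (of_bool (x i = a) - of_bool (x i = b))))"
    by (simp add: sum.cartesian_product[symmetric] h_def)
  also have "\<dots> = 2 * letter_form q (insert i S) D (\<lambda>x. real_of_int (g x))"
    using insert.prems insert.hyps assms letter_form_insert[of F q S i D "\<lambda>x. real_of_int (g x)"] by simp
  finally show ?case by simp
qed

section \<open>Krawtchouk polynomials as sums of kernels\<close>

text \<open>Sort the sets \<open>S\<close> by the number \<open>j\<close> of their coordinates at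
  which \<open>x\<close> and \<open>y\<close> differ. Each such coordinate contributes -1 and each
  of the other \<open>k - j\<close> contributes \<open>q - 1\<close>.\<close>

lemma krawtchouk_hamming_dist:
  "krawtchouk q n k (real (hamming_dist n x y)) =
    (\<Sum>S | S \<subseteq> {1..n} \<and> card S = k. letter_kernel q S x y)"
proof -
  define D where "D = {i \<in> {1..n}. x i \<noteq> y i}"
  define E where "E = {i \<in> {1..n}. x i = y i}"
  have DE: "D \<inter> E = {}" "D \<union> E = {1..n}" and fin: "finite D" "finite E"
    by (auto simp: D_def E_def)
  have "card D + card E = n"
    using card_Un_disjoint[OF fin DE(1)] DE(2) by simp
  then have cE: "real n - real (card D) = real (card E)" by linarith
  have kernel: "letter_kernel q (A \<union> B) x y = (- 1) ^ card A * (real q - 1) ^ card B"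
    if "A \<subseteq> D" "B \<subseteq> E" for A B
  proof -
    have "letter_kernel q (A \<union> B) x y = letter_kernel q A x y * letter_kernel q B x y"
      unfolding letter_kernel_def using that fin DE
      by (intro prod.union_disjoint) (auto intro: finite_subset)
    moreover have "letter_kernel q A x y = (\<Prod>i\<in>A. - 1)" "letter_kernel q B x y = (\<Prod>i\<in>B. real q - 1)"
      unfolding letter_kernel_def using that by (intro prod.cong; force simp: D_def E_def)+
    ultimately show ?thesis by simp
  qed
  let ?P = "\<lambda>j. {A. A \<subseteq> D \<and> card A = j} \<times> {B. B \<subseteq> E \<and> card B = k - j}"
  have "(\<Sum>S | S \<subseteq> {1..n} \<and> card S = k. letter_kernel q S x y)
      = (\<Sum>(j, A, B)\<in>(SIGMA j:{0..k}. ?P j). letter_kernel q (A \<union> B) x y)"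
  proof (rule sum.reindex_bij_witness[where i = "\<lambda>(j, A, B). A \<union> B"
        and j = "\<lambda>S. (card (S \<inter> D), S \<inter> D, S \<inter> E)"], goal_cases)
    case (1 S)
    then show ?case using DE by auto
  next
    case (2 S)
    then have "finite S" by (auto intro: finite_subset)
    then have "card (S \<inter> D) + card (S \<inter> E) = card ((S \<inter> D) \<union> (S \<inter> E))"
      using DE by (intro card_Un_disjoint[symmetric]) auto
    moreover have "(S \<inter> D) \<union> (S \<inter> E) = S" using 2 DE by auto
    ultimately show ?case using 2 by auto
  next
    case (3 p)
    then show ?case using DE by (auto simp: Int_Un_distrib2) (auto intro!: arg_cong[where f = card])
  next
    case (4 p)
    then show ?case using DE fin by (auto simp: card_Un_disjoint finite_subset disjoint_iff subset_eq intro!: card_Un_disjoint[THEN trans])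
  next
    case (5 S)
    then have "(S \<inter> D) \<union> (S \<inter> E) = S" using DE by auto
    then show ?case by simp
  qed
  also have "\<dots> = (\<Sum>j=0..k. \<Sum>(A, B)\<in>?P j. letter_kernel q (A \<union> B) x y)"
    using fin by (subst sum.Sigma[symmetric]) auto
  also have "\<dots> = (\<Sum>j=0..k. \<Sum>(A, B)\<in>?P j. (- 1) ^ j * (real q - 1) ^ (k - j))"
    by (intro sum.cong) (auto simp: kernel)
  also have "\<dots> = (\<Sum>j=0..k. (- 1) ^ j * (real q - 1) ^ (k - j) * real (card D choose j) * real (card E choose (k - j)))"
    using fin by (simp add: card_cartesian_product n_subsets mult_ac split_def)
  also have "\<dots> = krawtchouk q n k (real (hamming_dist n x y))"
    unfolding krawtchouk_def hamming_dist_def D_def[symmetric] cE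
    by (simp add: binomial_gbinomial)
  finally show ?thesis by simp
qed

section \<open>Distance counts and energies\<close>

lemma hamming_dist_self [simp]: "hamming_dist n x x = 0"
  by (simp add: hamming_dist_def)

lemma hamming_dist_commute: "hamming_dist n x y = hamming_dist n y x"
  unfolding hamming_dist_def by (rule arg_cong[where f = card]) auto

lemma hamming_dist_le: "hamming_dist n x y \<le> n"
proof -
  have "hamming_dist n x y \<le> card {1..n}"
    unfolding hamming_dist_def by (rule card_mono) auto
  then show ?thesis by simp
qed

lemma hamming_dist_eq_0_iff:
  assumes "x \<in> words F n" "y \<in> words F n"
  shows "hamming_dist n x y = 0 \<longleftrightarrow> x = y"
proof
  assume "hamming_dist n x y = 0"
  then have "\<forall>i\<in>{1..n}. x i = y i" by (auto simp: hamming_dist_def)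
  then show "x = y" using assms unfolding words_def by (intro PiE_ext) auto
qed simp

text \<open>Left unnormalised because these counts are later divided by different numbers: by the
  size of the code, or by the size of the comparison code minus 1.\<close>

definition pairs_at :: "nat \<Rightarrow> (nat \<Rightarrow> 'a) set \<Rightarrow> nat \<Rightarrow> real" where
  "pairs_at n D i = real (card {(x, y). x \<in> D \<and> y \<in> D \<and> hamming_dist n x y = i})"

definition codewords_at :: "nat \<Rightarrow> (nat \<Rightarrow> 'a) set \<Rightarrow> (nat \<Rightarrow> 'a) \<Rightarrow> nat \<Rightarrow> real" where
  "codewords_at n D x i = real (card {z \<in> D. hamming_dist n x z = i})"

lemma sum_codewords_at:
  assumes "finite D"
  shows "(\<Sum>i = 0..n. codewords_at n D x i * g i) = (\<Sum>y\<in>D. g (hamming_dist n x y))"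
proof -
  have "(\<Sum>y\<in>D. g (hamming_dist n x y))
      = (\<Sum>i = 0..n. \<Sum>y | y \<in> D \<and> hamming_dist n x y = i. g (hamming_dist n x y))"
    using assms hamming_dist_le by (intro sum.group[symmetric]) auto
  also have "\<dots> = (\<Sum>i = 0..n. codewords_at n D x i * g i)"
    by (intro sum.cong) (simp_all add: codewords_at_def)
  finally show ?thesis by simp
qed

lemma pairs_at_eq_sum:
  assumes "finite D"
  shows "pairs_at n D i = (\<Sum>x\<in>D. codewords_at n D x i)"
proof -
  have "{(x, y). x \<in> D \<and> y \<in> D \<and> hamming_dist n x y = i}
      = (SIGMA x:D. {y \<in> D. hamming_dist n x y = i})" by auto
  then show ?thesis
    using assms by (simp add: pairs_at_def codewords_at_def card_SigmaI)
qed

lemma sum_pairs_at: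
  assumes "finite D"
  shows "(\<Sum>i = 0..n. pairs_at n D i * g i) = (\<Sum>x\<in>D. \<Sum>y\<in>D. g (hamming_dist n x y))"
proof -
  have "(\<Sum>i = 0..n. pairs_at n D i * g i) = (\<Sum>i = 0..n. \<Sum>x\<in>D. codewords_at n D x i * g i)"
    using assms by (simp add: pairs_at_eq_sum sum_distrib_right)
  also have "\<dots> = (\<Sum>x\<in>D. \<Sum>y\<in>D. g (hamming_dist n x y))"
    using assms by (subst sum.swap) (simp add: sum_codewords_at)
  finally show ?thesis .
qed

lemma distance_distribution_eq: "distance_distribution n C i = pairs_at n C i / real (card C)"
  by (simp add: distance_distribution_def pairs_at_def)

lemma finite_words: "finite F \<Longrightarrow> finite (words F n)"
  by (simp add: words_def finite_PiE)

lemma codewords_at_0: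
  assumes "D \<subseteq> words F n" "c \<in> D"
  shows "codewords_at n D c 0 = 1"
proof -
  have "{z \<in> D. hamming_dist n c z = 0} = {c}"
    using assms hamming_dist_eq_0_iff[of c F n] by auto
  then show ?thesis by (simp add: codewords_at_def)
qed

lemma pairs_at_0:
  assumes "finite D" "D \<subseteq> words F n"
  shows "pairs_at n D 0 = real (card D)"
  using assms by (simp add: pairs_at_eq_sum codewords_at_0)

definition total_energy :: "nat \<Rightarrow> (nat \<Rightarrow> real) \<Rightarrow> (nat \<Rightarrow> 'a) set \<Rightarrow> real" where
  "total_energy n f D = (\<Sum>i = 1..n. pairs_at n D i * f i)"

text \<open>Setting the potential to 0 at distance 0 lets sums run over all distances, and so over
  all pairs of words including the diagonal.\<close>

lemma sum_positive_distances:
  fixes a f :: "nat \<Rightarrow> real"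
  shows "(\<Sum>i = 1..n. a i * f i) = (\<Sum>i = 0..n. a i * (f(0 := 0)) i)"
proof -
  have "(\<Sum>i = 0..n. a i * (f(0 := 0)) i) = (\<Sum>i = 1..n. a i * (f(0 := 0)) i)"
    by (simp add: sum.atLeast_Suc_atMost)
  then show ?thesis by simp
qed

lemma total_energy_eq:
  assumes "finite D"
  shows "total_energy n f D = (\<Sum>x\<in>D. \<Sum>y\<in>D. (f(0 := 0)) (hamming_dist n x y))"
  unfolding total_energy_def sum_positive_distances using assms by (rule sum_pairs_at)

lemma energy_eq:
  assumes "finite D" "D \<subseteq> words F n"
  shows "energy n f D = total_energy n f D / real (card D)"
proof -
  have "hamming_dist n x y = 0 \<longleftrightarrow> x = y" if "x \<in> D" "y \<in> D" for x y
    using assms(2) that by (intro hamming_dist_eq_0_iff) auto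
  then have "(\<Sum>(x, y) \<in> {(x, y). x \<in> D \<and> y \<in> D \<and> x \<noteq> y}. f (hamming_dist n x y))
      = (\<Sum>(x, y) \<in> D \<times> D. (f(0 := 0)) (hamming_dist n x y))"
    using assms by (intro sum.mono_neutral_cong_left) auto
  then show ?thesis
    using assms by (simp only: energy_def total_energy_eq sum.cartesian_product)
qed

text \<open>The row and the column of \<open>c\<close> disappear. They are equal by symmetry, and
  the entry they share is 0, so nothing is subtracted twice by mistake.\<close>

lemma total_energy_remove:
  assumes "finite C" "c \<in> C"
  shows "total_energy n f (C - {c}) = total_energy n f C - 2 * (\<Sum>i = 1..n. codewords_at n C c i * f i)"
proof -
  let ?g = "f(0 := 0)" and ?d = "hamming_dist n" and ?D = "C - {c}"
  have fin: "finite ?D" using assms by auto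
  have split: "(\<Sum>y\<in>C. ?g (?d x y)) = ?g (?d x c) + (\<Sum>y\<in>?D. ?g (?d x y))" for x
    using assms by (simp only: sum.remove)
  have "total_energy n f C = (\<Sum>y\<in>C. ?g (?d c y)) + (\<Sum>x\<in>?D. \<Sum>y\<in>C. ?g (?d x y))"
    unfolding total_energy_eq[OF assms(1)] using assms by (rule sum.remove)
  also have "(\<Sum>x\<in>?D. \<Sum>y\<in>C. ?g (?d x y)) = (\<Sum>x\<in>?D. ?g (?d x c)) + total_energy n f ?D"
    unfolding total_energy_eq[OF fin] split by (rule sum.distrib)
  also have "(\<Sum>x\<in>?D. ?g (?d x c)) = (\<Sum>y\<in>C. ?g (?d c y))"
    unfolding split by (simp add: hamming_dist_commute[of n c])
  also have "(\<Sum>y\<in>C. ?g (?d c y)) = (\<Sum>i = 1..n. codewords_at n C c i * f i)"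
    unfolding sum_positive_distances using sum_codewords_at[OF assms(1), of n c ?g] by simp
  finally show ?thesis by simp
qed

section \<open>Completely monotonic potentials\<close>

lemma completely_monotonic_antimono:
  assumes "completely_monotonic a b f" "a \<le> i" "i \<le> b"
  shows "f b \<le> f i"
  using assms(3,2)
proof (induction i rule: inc_induct)
  case (step i)
  then have "0 \<le> (- 1) ^ 1 * (fwd_diff ^^ 1) f i"
    using assms(1) unfolding completely_monotonic_def by (metis Suc_eq_plus1 Suc_leI)
  then show ?case using step by (simp add: fwd_diff_def)
qed simp

text \<open>By Pascal's rule each difference flips the sign and lowers both binomial arguments by 1,
  until the constant 1 is reached at \<open>r = k\<close>. The bound on \<open>i + r\<close> keeps
  the subtractions from truncating.\<close>

lemma fwd_diff_binomial:
  assumes "i + r \<le> n"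
  shows "(fwd_diff ^^ r) (\<lambda>m. real (n - m choose k)) i
       = (if r \<le> k then (- 1) ^ r * real (n - i - r choose (k - r)) else 0)"
  using assms
proof (induction r arbitrary: i)
  case (Suc r)
  then have IH: "(fwd_diff ^^ r) (\<lambda>m. real (n - m choose k)) j
       = (if r \<le> k then (- 1) ^ r * real (n - j - r choose (k - r)) else 0)" if "j \<in> {i, Suc i}" for j
    using that by (intro Suc.IH) auto
  obtain l where l: "n - i - r = Suc l" "n - Suc i - r = l"
    using Suc.prems by (metis Suc_diff_Suc add_Suc_right diff_Suc_eq_diff_pred diff_diff_left Suc_le_lessD plus_1_eq_Suc add.commute)
  have step: "(fwd_diff ^^ Suc r) g i = (fwd_diff ^^ r) g (Suc i) - (fwd_diff ^^ r) g i" for g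
    by (simp add: fwd_diff_def[of "(fwd_diff ^^ r) _"])
  consider "r < k" | "r = k" | "k < r" by linarith
  then show ?case
  proof cases
    case 1
    then obtain s where "k - r = Suc s" "k - Suc r = s" by (metis Suc_diff_Suc)
    then show ?thesis using 1 l by (simp add: step IH algebra_simps del: funpow.simps)
  next
    case 2
    then show ?thesis unfolding step using IH[of i] IH[of "Suc i"] by simp
  next
    case 3
    then show ?thesis unfolding step by (simp add: IH)
  qed
qed simp

lemma completely_monotonic_binomial:
  "completely_monotonic a n (\<lambda>m. real (n - m choose k))"
  unfolding completely_monotonic_def
  by (auto simp: fwd_diff_binomial)

text \<open>The system is triangular: in the moment with \<open>k = n - i\<close>, the coefficient
  of \<open>a l\<close> vanishes for \<open>l > i\<close> and equals 1 for
  \<open>l = i\<close>.\<close>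

lemma binomial_moments_determine:
  fixes a b :: "nat \<Rightarrow> real"
  assumes "\<And>k. (\<Sum>i = 1..n. a i * real (n - i choose k)) = (\<Sum>i = 1..n. b i * real (n - i choose k))"
    and "i \<in> {1..n}"
  shows "a i = b i"
  using assms(2)
proof (induction i rule: less_induct)
  case (less i)
  have split: "(\<Sum>l = 1..n. c l * real (n - l choose (n - i)))
      = c i + (\<Sum>l\<in>{1..n} - {i}. c l * real (n - l choose (n - i)))" for c :: "nat \<Rightarrow> real"
    using less.prems by (subst sum.remove[of _ i]) auto
  have "(\<Sum>l\<in>{1..n} - {i}. a l * real (n - l choose (n - i)))
      = (\<Sum>l\<in>{1..n} - {i}. b l * real (n - l choose (n - i)))"
  proof (rule sum.cong)
    fix l assume l: "l \<in> {1..n} - {i}"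
    show "a l * real (n - l choose (n - i)) = b l * real (n - l choose (n - i))"
    proof (cases "l < i")
      case True
      then show ?thesis using less.IH l by simp
    next
      case False
      then have "n - l < n - i" using l less.prems by auto
      then show ?thesis by (simp add: binomial_eq_0)
    qed
  qed simp
  then show ?case using assms(1)[of "n - i"] unfolding split by simp
qed

section \<open>Perturbing the distance distribution\<close>

text \<open>The vector \<open>B\<close> may violate Delsarte inequalities that are strict at the
  distance distribution, since a mixture with a small share of \<open>B\<close> still satisfies
  them. Both constraints and objective are linear, so optimality against the mixture passes to
  \<open>B\<close>.\<close>

lemma lp_universally_optimal_le:
  fixes B :: "nat \<Rightarrow> real"
  assumes opt: "lp_universally_optimal q n C" and cm: "completely_monotonic 1 n f"
    and A: "quasicode q n (real (card C)) (distance_distribution n C)"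
    and B: "B 0 = 1" "\<And>i. i \<le> n \<Longrightarrow> 0 \<le> B i" "(\<Sum>i = 0..n. B i) = real (card C)"
    and T: "\<And>j. j \<in> {1..n} \<Longrightarrow>
        0 < (\<Sum>i = 0..n. distance_distribution n C i * krawtchouk q n j (real i)) \<or>
        0 \<le> (\<Sum>i = 0..n. B i * krawtchouk q n j (real i))"
  shows "(\<Sum>i = 1..n. distance_distribution n C i * f i) \<le> (\<Sum>i = 1..n. B i * f i)"
proof -
  let ?A = "distance_distribution n C"
  define TA where "TA j = (\<Sum>i = 0..n. ?A i * krawtchouk q n j (real i))" for j
  define TB where "TB j = (\<Sum>i = 0..n. B i * krawtchouk q n j (real i))" for j
  have lt1: "eventually (\<lambda>\<epsilon>::real. \<epsilon> < 1) (at_right 0)"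
    by (rule eventually_at_rightI[of 0 1]) auto
  have gt0: "eventually (\<lambda>\<epsilon>::real. 0 < \<epsilon>) (at_right 0)"
    by (rule eventually_at_rightI[of 0 1]) auto
  have "eventually (\<lambda>\<epsilon>. 0 \<le> (1 - \<epsilon>) * TA j + \<epsilon> * TB j) (at_right 0)" if j: "j \<in> {1..n}" for j
  proof (cases "0 < TA j")
    case True
    have "((\<lambda>\<epsilon>. (1 - \<epsilon>) * TA j + \<epsilon> * TB j) \<longlongrightarrow> (1 - 0) * TA j + 0 * TB j) (at_right 0)"
      by (intro tendsto_intros)
    then have "eventually (\<lambda>\<epsilon>. 0 < (1 - \<epsilon>) * TA j + \<epsilon> * TB j) (at_right 0)"
      using True by (intro order_tendstoD(1)) auto
    then show ?thesis by eventually_elim simp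
  next
    case False
    then have TB: "0 \<le> TB j" using T[OF j] by (simp add: TA_def TB_def)
    have TA: "0 \<le> TA j" using A j by (simp add: quasicode_def TA_def)
    show ?thesis using lt1 gt0 by eventually_elim (use TA TB in simp)
  qed
  \<comment> \<open>There are finitely many \<open>j\<close>, so a single \<epsilon> serves them
    all.\<close>
  then have "eventually (\<lambda>\<epsilon>. \<forall>j\<in>{1..n}. 0 \<le> (1 - \<epsilon>) * TA j + \<epsilon> * TB j) (at_right 0)"
    by (simp add: eventually_ball_finite)
  then have "eventually (\<lambda>\<epsilon>. 0 < \<epsilon> \<and> \<epsilon> < 1 \<and> (\<forall>j\<in>{1..n}. 0 \<le> (1 - \<epsilon>) * TA j + \<epsilon> * TB j)) (at_right 0)"
    using lt1 gt0 by eventually_elim simp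
  then obtain \<epsilon> where \<epsilon>: "0 < \<epsilon>" "\<epsilon> < 1" "\<forall>j\<in>{1..n}. 0 \<le> (1 - \<epsilon>) * TA j + \<epsilon> * TB j"
    using eventually_happens'[OF trivial_limit_at_right_real] by blast
  define M where "M i = (1 - \<epsilon>) * ?A i + \<epsilon> * B i" for i
  have M: "(\<Sum>i\<in>I. M i * g i) = (1 - \<epsilon>) * (\<Sum>i\<in>I. ?A i * g i) + \<epsilon> * (\<Sum>i\<in>I. B i * g i)"
    for I and g :: "nat \<Rightarrow> real"
    by (simp add: M_def distrib_right sum.distrib sum_distrib_left mult.assoc)
  have "quasicode q n (real (card C)) M"
    unfolding quasicode_def
  proof (intro conjI ballI)
    show "M 0 = 1" using A B by (simp add: M_def quasicode_def)
    show "0 \<le> M i" if "i \<in> {0..n}" for i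
      using A B that \<epsilon> by (simp add: M_def quasicode_def)
    show "sum M {0..n} = real (card C)"
      using M[of "\<lambda>_. 1" "{0..n}"] A B by (simp add: quasicode_def algebra_simps)
    show "0 \<le> (\<Sum>i = 0..n. M i * krawtchouk q n j (real i))" if "j \<in> {1..n}" for j
      using \<epsilon>(3) that by (simp add: M TA_def TB_def)
  qed
  then have "(\<Sum>i = 1..n. ?A i * f i) \<le> (\<Sum>i = 1..n. M i * f i)"
    using opt cm unfolding lp_universally_optimal_def by blast
  then have "\<epsilon> * (\<Sum>i = 1..n. ?A i * f i) \<le> \<epsilon> * (\<Sum>i = 1..n. B i * f i)"
    unfolding M by (simp add: algebra_simps)
  then show ?thesis using \<epsilon>(1) by simp
qed

section \<open>Delsarte inequalities and their refinements\<close>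

locale hamming_space =
  fixes F :: "'a set" and q n :: nat
  assumes finite_F: "finite F" and card_F: "card F = q" and q_ge_2: "2 \<le> q"
begin

lemma finite_code: "D \<subseteq> words F n \<Longrightarrow> finite D"
  using finite_words[OF finite_F] finite_subset by blast

lemma krawtchouk_form:
  "(\<Sum>x\<in>D. \<Sum>y\<in>D. g x * g y * krawtchouk q n j (real (hamming_dist n x y)))
     = (\<Sum>S | S \<subseteq> {1..n} \<and> card S = j. letter_form q S D g)"
proof -
  have "(\<Sum>x\<in>D. \<Sum>y\<in>D. g x * g y * krawtchouk q n j (real (hamming_dist n x y)))
      = (\<Sum>x\<in>D. \<Sum>S | S \<subseteq> {1..n} \<and> card S = j. \<Sum>y\<in>D. g x * g y * letter_kernel q S x y)"
    unfolding krawtchouk_hamming_dist sum_distrib_left by (intro sum.cong refl sum.swap)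
  also have "\<dots> = (\<Sum>S | S \<subseteq> {1..n} \<and> card S = j. letter_form q S D g)"
    unfolding letter_form_def by (rule sum.swap)
  finally show ?thesis .
qed

lemma krawtchouk_form_nonneg:
  assumes "D \<subseteq> words F n"
  shows "0 \<le> (\<Sum>x\<in>D. \<Sum>y\<in>D. g x * g y * krawtchouk q n j (real (hamming_dist n x y)))"
  unfolding krawtchouk_form
  using assms by (intro sum_nonneg letter_form_nonneg[OF finite_F card_F])
    (auto simp: words_def intro: finite_subset)

lemma krawtchouk_0: "krawtchouk q n j 0 = (\<Sum>S | S \<subseteq> {1..n} \<and> card S = j. (real q - 1) ^ card S)"
proof -
  have "krawtchouk q n j 0 = krawtchouk q n j (real (hamming_dist n (\<lambda>_. undefined) (\<lambda>_. undefined)))"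
    by simp
  then show ?thesis unfolding krawtchouk_hamming_dist letter_kernel_def by simp
qed

lemma krawtchouk_0_pos:
  assumes "j \<le> n"
  shows "0 < krawtchouk q n j 0"
proof -
  have "krawtchouk q n j 0 = real (n choose j) * (real q - 1) ^ j"
    unfolding krawtchouk_0 by (simp add: n_subsets)
  then show ?thesis using assms q_ge_2 by simp
qed

text \<open>The lower bound is the value attained by a one-word code. It comes from
  \<open>letter_form_ge\<close> with unit weights, summed over the \<open>j\<close>-sets of
  coordinates.\<close>

lemma krawtchouk_sum_ge:
  assumes "D \<subseteq> words F n" "\<not> q dvd card D"
  shows "krawtchouk q n j 0 \<le> (\<Sum>x\<in>D. \<Sum>y\<in>D. krawtchouk q n j (real (hamming_dist n x y)))"
proof -
  have "krawtchouk q n j 0 \<le> (\<Sum>S | S \<subseteq> {1..n} \<and> card S = j. letter_form q S D (\<lambda>x. real_of_int 1))"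
    unfolding krawtchouk_0
  proof (rule sum_mono, rule letter_form_ge[OF finite_F card_F])
    fix S assume S: "S \<in> {S. S \<subseteq> {1..n} \<and> card S = j}"
    then show "finite S" by (auto intro: finite_subset)
    show "x i \<in> F" if "x \<in> D" "i \<in> S" for x i
      using assms S that by (auto simp: words_def)
    show "\<not> int q dvd (\<Sum>x\<in>D. 1)" using assms by simp
  qed
  then show ?thesis
    unfolding krawtchouk_form[symmetric] by simp
qed

lemma krawtchouk_sum_nonneg:
  assumes "D \<subseteq> words F n"
  shows "0 \<le> (\<Sum>x\<in>D. \<Sum>y\<in>D. krawtchouk q n j (real (hamming_dist n x y)))"
  using krawtchouk_form_nonneg[OF assms, of "\<lambda>_. 1" j] by simp

text \<open>A null vector of a semidefinite form lies in its kernel. Here the null vector is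
  constantly 1; adding \<open>s\<close> to its entry at \<open>c\<close> gives the form the value
  \<open>2 * s * R + s\<^sup>2 * k c c\<close>, which cannot be nonnegative for all \<open>s\<close>
  unless \<open>R = 0\<close>.\<close>

lemma krawtchouk_row_eq_0:
  assumes D: "D \<subseteq> words F n" "c \<in> D"
    and zero: "(\<Sum>x\<in>D. \<Sum>y\<in>D. krawtchouk q n j (real (hamming_dist n x y))) = 0"
  shows "(\<Sum>y\<in>D. krawtchouk q n j (real (hamming_dist n c y))) = 0"
proof -
  define k where "k x y = krawtchouk q n j (real (hamming_dist n x y))" for x y :: "nat \<Rightarrow> 'a"
  define R where "R = (\<Sum>y\<in>D. k c y)"
  have fin: "finite D" using finite_code D by blast
  have sym: "k x y = k y x" for x y by (simp add: k_def hamming_dist_commute)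
  have pick: "(\<Sum>y\<in>D. of_bool (y = c) * h y) = h c" for h :: "(nat \<Rightarrow> 'a) \<Rightarrow> real"
    using fin D by (subst sum.remove[of _ c]) auto
  have ineq: "0 \<le> 2 * s * R + s\<^sup>2 * k c c" for s :: real
  proof -
    have "0 \<le> (\<Sum>x\<in>D. \<Sum>y\<in>D. (1 + s * of_bool (x = c)) * (1 + s * of_bool (y = c)) * k x y)"
      unfolding k_def by (rule krawtchouk_form_nonneg[OF D(1)])
    also have "\<dots> = (\<Sum>x\<in>D. (1 + s * of_bool (x = c)) * ((\<Sum>y\<in>D. k x y) + s * k x c))"
    proof (rule sum.cong[OF refl])
      fix x
      have "(\<Sum>y\<in>D. (1 + s * of_bool (x = c)) * (1 + s * of_bool (y = c)) * k x y)
          = (1 + s * of_bool (x = c)) * ((\<Sum>y\<in>D. k x y) + s * (\<Sum>y\<in>D. of_bool (y = c) * k x y))"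
        by (simp only: sum_distrib_left flip: sum.distrib) (simp only: algebra_simps mult_1)
      also have "(\<Sum>y\<in>D. of_bool (y = c) * k x y) = k x c"
        by (rule pick)
      finally show "(\<Sum>y\<in>D. (1 + s * of_bool (x = c)) * (1 + s * of_bool (y = c)) * k x y)
          = (1 + s * of_bool (x = c)) * ((\<Sum>y\<in>D. k x y) + s * k x c)" .
    qed
    also have "\<dots> = (\<Sum>x\<in>D. \<Sum>y\<in>D. k x y) + s * (\<Sum>x\<in>D. k x c)
        + s * (\<Sum>x\<in>D. of_bool (x = c) * ((\<Sum>y\<in>D. k x y) + s * k x c))"
      by (simp only: sum_distrib_left flip: sum.distrib) (simp only: algebra_simps mult_1)
    also have "(\<Sum>x\<in>D. of_bool (x = c) * ((\<Sum>y\<in>D. k x y) + s * k x c)) = R + s * k c c"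
      by (simp only: pick R_def)
    also have "(\<Sum>x\<in>D. k x c) = R" by (simp add: R_def sym[of _ c])
    also have "(\<Sum>x\<in>D. \<Sum>y\<in>D. k x y) = 0" using zero by (simp add: k_def)
    finally show ?thesis by (simp add: algebra_simps power2_eq_square)
  qed
  \<comment> \<open>Taking \<open>s = - t\<close> makes the form \<open>t\<^sup>2\<close> times a
    negative number. The summand 1 keeps the denominator positive even if
    \<open>k c c = 0\<close>.\<close>
  define t where "t = R / (1 + \<bar>k c c\<bar>)"
  have R: "R = t * (1 + \<bar>k c c\<bar>)" by (simp add: t_def)
  have "0 \<le> 2 * (- t) * R + (- t)\<^sup>2 * k c c" by (rule ineq)
  also have "\<dots> = t\<^sup>2 * (k c c - 2 * (1 + \<bar>k c c\<bar>))"
    unfolding R by (simp add: algebra_simps power2_eq_square)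
  finally have "t = 0" by (auto simp: zero_le_mult_iff)
  then show ?thesis using R by (simp add: R_def k_def)
qed

lemma transform_distance_distribution:
  assumes "C \<subseteq> words F n"
  shows "(\<Sum>i = 0..n. distance_distribution n C i * g (real i))
       = (\<Sum>x\<in>C. \<Sum>y\<in>C. g (real (hamming_dist n x y))) / real (card C)"
  using sum_pairs_at[OF finite_code[OF assms], of n "\<lambda>i. g (real i)"]
  by (simp add: distance_distribution_eq flip: sum_divide_distrib)

lemma quasicode_distance_distribution:
  assumes "C \<subseteq> words F n" "C \<noteq> {}"
  shows "quasicode q n (real (card C)) (distance_distribution n C)"
proof -
  have "finite C" using assms finite_code by blast
  then have "0 < card C" using assms by (simp add: card_gt_0_iff)
  show ?thesis
    unfolding quasicode_def
  proof (intro conjI ballI)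
    show "distance_distribution n C 0 = 1"
      using pairs_at_0[OF \<open>finite C\<close> assms(1)] \<open>0 < card C\<close> by (simp add: distance_distribution_eq)
    show "0 \<le> distance_distribution n C i" for i
      by (simp add: distance_distribution_def)
    show "(\<Sum>i = 0..n. distance_distribution n C i) = real (card C)"
      using transform_distance_distribution[OF assms(1), of "\<lambda>_. 1"] by simp
    show "0 \<le> (\<Sum>i = 0..n. distance_distribution n C i * krawtchouk q n j (real i))" for j
      unfolding transform_distance_distribution[OF assms(1)]
      using krawtchouk_sum_nonneg[OF assms(1)] by (rule divide_nonneg_nonneg) simp
  qed
qed

end

section \<open>Consequences of LP universal optimality\<close>

locale lp_optimal_code = hamming_space +
  fixes C :: "(nat \<Rightarrow> 'a) set"
  assumes code: "C \<subseteq> words F n" and n_pos: "1 \<le> n" and nonempty: "C \<noteq> {}"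
    and lp_opt: "lp_universally_optimal q n C"
begin

lemma finite_C: "finite C"
  using code by (rule finite_code)

lemma card_C_pos: "0 < card C"
  using nonempty finite_C by (simp add: card_gt_0_iff)

lemmas lp_le = lp_universally_optimal_le[OF lp_opt _ quasicode_distance_distribution[OF code nonempty]]

text \<open>Comparison with the distances seen from \<open>x\<close> shows that no codeword lies
  below the average \<open>E\<close>. The deviations from an average sum to 0, so all of them
  vanish.\<close>

lemma codeword_energy:
  assumes cm: "completely_monotonic 1 n f" and c: "c \<in> C"
  shows "(\<Sum>i = 1..n. codewords_at n C c i * f i) = total_energy n f C / real (card C)"
proof -
  define e where "e x = (\<Sum>i = 1..n. codewords_at n C x i * f i)" for x
  define E where "E = total_energy n f C / real (card C)"
  have "E \<le> e x" if "x \<in> C" for x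
  proof -
    have "(\<Sum>i = 1..n. distance_distribution n C i * f i) \<le> e x"
      unfolding e_def
    proof (rule lp_le[OF cm])
      show "codewords_at n C x 0 = 1" using code that by (rule codewords_at_0)
      show "(\<Sum>i = 0..n. codewords_at n C x i) = real (card C)"
        using sum_codewords_at[OF finite_C, of n x "\<lambda>_. 1"] by simp
      fix j
      let ?Q = "\<Sum>x\<in>C. \<Sum>y\<in>C. krawtchouk q n j (real (hamming_dist n x y))"
      show "0 < (\<Sum>i = 0..n. distance_distribution n C i * krawtchouk q n j (real i)) \<or>
          0 \<le> (\<Sum>i = 0..n. codewords_at n C x i * krawtchouk q n j (real i))"
      proof (cases "?Q = 0")
        case True
        then show ?thesis
          using krawtchouk_row_eq_0[OF code that True] finite_C by (simp add: sum_codewords_at)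
      next
        case False
        then have "0 < ?Q" using krawtchouk_sum_nonneg[OF code, of j] by simp
        then show ?thesis using card_C_pos code by (simp add: transform_distance_distribution)
      qed
    qed (simp add: codewords_at_def)
    then show ?thesis
      by (simp add: E_def total_energy_def distance_distribution_eq sum_divide_distrib)
  qed
  moreover have "(\<Sum>x\<in>C. e x - E) = 0"
  proof -
    have "(\<Sum>x\<in>C. e x) = total_energy n f C"
      unfolding e_def total_energy_def pairs_at_eq_sum[OF finite_C] sum_distrib_right by (rule sum.swap)
    then show ?thesis using card_C_pos by (simp add: sum_subtractf E_def)
  qed
  ultimately have "e c - E = 0"
    using c finite_C by (subst (asm) sum_nonneg_eq_0_iff) auto
  then show ?thesis by (simp add: e_def E_def)
qed

lemma distance_regular_code: "distance_regular n C"
  unfolding distance_regular_def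
proof (intro allI ballI)
  fix i x y assume xy: "x \<in> C" "y \<in> C"
  have "codewords_at n C x i = codewords_at n C y i"
  proof -
    \<comment> \<open>Potentials only see the distances from 1 to \<open>n\<close>; the remaining
      ones are settled directly.\<close>
    consider "i = 0" | "i \<in> {1..n}" | "n < i" by fastforce
    then show ?thesis
    proof cases
      case 1
      then show ?thesis using xy code by (simp add: codewords_at_0)
    next
      case 2
      show ?thesis
        by (rule binomial_moments_determine[OF _ 2])
          (simp only: codeword_energy[OF completely_monotonic_binomial] xy)
    next
      case 3
      then have "hamming_dist n u z \<noteq> i" for u z :: "nat \<Rightarrow> 'a"
        using hamming_dist_le[of n u z] by simp
      then show ?thesis by (simp add: codewords_at_def)
    qed
  qed
  then show "card {z \<in> C. hamming_dist n x z = i} = card {z \<in> C. hamming_dist n y z = i}"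
    by (simp add: codewords_at_def)
qed

text \<open>The left side is the total energy of \<open>C\<close> with one codeword deleted:
  \<open>N\<close> times the average, less twice the average for the lost row and column.\<close>

lemma total_energy_le:
  assumes cm: "completely_monotonic 1 n f" and C': "C' \<subseteq> words F n" "card C = card C' + 1"
    and N: "3 \<le> card C"
  shows "(real (card C) - 2) * (\<Sum>i = 1..n. distance_distribution n C i * f i) \<le> total_energy n f C'"
proof -
  define N where "N = real (card C)"
  have N3: "3 \<le> N" and cC': "real (card C') = N - 1" using N C' by (simp_all add: N_def)
  have fin: "finite C'" using C' finite_code by blast
  have total: "(\<Sum>i = 0..n. pairs_at n C' i) = (N - 1)\<^sup>2"
    using sum_pairs_at[OF fin, of n "\<lambda>_. 1"] cC' by (simp add: power2_eq_square)
  have P0: "pairs_at n C' 0 = N - 1"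
    using pairs_at_0[OF fin C'(1)] cC' by simp
  show ?thesis
  proof (cases "q dvd card C")
    case True
    have ndvd: "\<not> q dvd card C'"
    proof
      assume "q dvd card C'"
      then have "q dvd 1" using True C' by (metis dvd_add_right_iff)
      then show False using q_ge_2 by simp
    qed
    \<comment> \<open>Lowering the diagonal count \<open>N - 1\<close> by 1 makes division by
      \<open>N - 2\<close> give \<open>B 0 = 1\<close> and total
      \<open>((N - 1)\<^sup>2 - 1) / (N - 2) = N\<close>. The change costs
      \<open>krawtchouk q n j 0\<close> in each inequality, exactly what
      \<open>krawtchouk_sum_ge\<close> provides.\<close>
    define B where "B i = (pairs_at n C' i - of_bool (i = 0)) / (N - 2)" for i
    have B: "(\<Sum>i = 0..n. B i * g i) = ((\<Sum>i = 0..n. pairs_at n C' i * g i) - g 0) / (N - 2)"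
      for g :: "nat \<Rightarrow> real"
    proof -
      have "(\<Sum>i = 0..n. B i * g i) = (\<Sum>i = 0..n. pairs_at n C' i * g i - of_bool (i = 0) * g i) / (N - 2)"
        by (simp add: B_def sum_divide_distrib algebra_simps)
      moreover have "(\<Sum>i = 0..n. of_bool (i = 0) * g i) = g 0"
        by (simp add: sum.atLeast_Suc_atMost)
      ultimately show ?thesis by (simp only: sum_subtractf)
    qed
    have "(\<Sum>i = 1..n. distance_distribution n C i * f i) \<le> (\<Sum>i = 1..n. B i * f i)"
    proof (rule lp_le[OF cm])
      show "B 0 = 1" using P0 N3 by (simp add: B_def)
      show "0 \<le> B i" for i
        using P0 N3 by (cases "i = 0") (simp_all add: B_def, simp add: pairs_at_def)
      show "(\<Sum>i = 0..n. B i) = real (card C)"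
      proof -
        have "(N - 1)\<^sup>2 - 1 = N * (N - 2)" by (simp add: power2_eq_square algebra_simps)
        then show ?thesis using B[of "\<lambda>_. 1"] total N3 by (simp add: N_def)
      qed
      fix j
      have "0 \<le> (\<Sum>i = 0..n. B i * krawtchouk q n j (real i))"
        using krawtchouk_sum_ge[OF C'(1) ndvd, of j] N3
        by (simp add: B sum_pairs_at[OF fin])
      then show "0 < (\<Sum>i = 0..n. distance_distribution n C i * krawtchouk q n j (real i)) \<or>
          0 \<le> (\<Sum>i = 0..n. B i * krawtchouk q n j (real i))" ..
    qed
    also have "(\<Sum>i = 1..n. B i * f i) = total_energy n f C' / (N - 2)"
      by (simp add: B_def total_energy_def sum_divide_distrib)
    finally show ?thesis using N3 by (simp add: N_def[symmetric] field_simps)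
  next
    case False
    \<comment> \<open>One word at distance 0 and all others at distance \<open>n\<close>. This need
      not be a quasicode; it only serves as a direction of perturbation.\<close>
    define B where "B i = of_bool (i = 0) + (N - 1) * of_bool (i = n)" for i :: nat
    have B: "(\<Sum>i = 1..n. B i * g i) = (N - 1) * g n" for g :: "nat \<Rightarrow> real"
    proof -
      have "(\<Sum>i = 1..n. B i * g i) = (\<Sum>i = 1..n. if i = n then (N - 1) * g i else 0)"
        by (intro sum.cong) (auto simp: B_def)
      then show ?thesis using n_pos by simp
    qed
    have "(\<Sum>i = 1..n. distance_distribution n C i * f i) \<le> (\<Sum>i = 1..n. B i * f i)"
    proof (rule lp_le[OF cm])
      show B0: "B 0 = 1" using n_pos by (simp add: B_def)
      show "0 \<le> B i" for i using N3 by (simp add: B_def)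
      show "(\<Sum>i = 0..n. B i) = real (card C)"
        using B[of "\<lambda>_. 1"] B0 by (simp add: sum.atLeast_Suc_atMost N_def)
      fix j assume "j \<in> {1..n}"
      then have "0 < (\<Sum>x\<in>C. \<Sum>y\<in>C. krawtchouk q n j (real (hamming_dist n x y)))"
        using krawtchouk_sum_ge[OF code False, of j] krawtchouk_0_pos[of j] by simp
      then show "0 < (\<Sum>i = 0..n. distance_distribution n C i * krawtchouk q n j (real i)) \<or>
          0 \<le> (\<Sum>i = 0..n. B i * krawtchouk q n j (real i))"
        using card_C_pos code by (simp add: transform_distance_distribution)
    qed
    then have "(N - 2) * (\<Sum>i = 1..n. distance_distribution n C i * f i) \<le> (N - 2) * ((N - 1) * f n)"
      using N3 unfolding B by (intro mult_left_mono) simp_all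
    \<comment> \<open>\<open>(N - 1) * (N - 2)\<close> counts the ordered pairs of distinct words of
      \<open>C'\<close>, each of which has energy at least \<open>f n\<close>.\<close>
    also have "\<dots> = (\<Sum>i = 1..n. pairs_at n C' i * f n)"
    proof -
      have "(\<Sum>i = 1..n. pairs_at n C' i) = (N - 1)\<^sup>2 - (N - 1)"
        using total P0 by (simp add: sum.atLeast_Suc_atMost)
      then show ?thesis
        unfolding sum_distrib_right[symmetric]
        by (simp only:) (simp add: power2_eq_square algebra_simps)
    qed
    also have "\<dots> \<le> total_energy n f C'"
      unfolding total_energy_def
      using completely_monotonic_antimono[OF cm]
      by (intro sum_mono mult_left_mono) (auto simp: pairs_at_def)
    finally show ?thesis by (simp add: N_def)
  qed
qed

lemma universally_optimal_remove:
  assumes c: "c \<in> C"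
  shows "universally_optimal F n (C - {c})"
  unfolding universally_optimal_def
proof (intro allI impI, elim conjE)
  fix f C'
  assume cm: "completely_monotonic 1 n f" and C': "C' \<subseteq> words F n" "card C' = card (C - {c})"
  have card: "card C = card C' + 1"
    using c finite_C C' card_C_pos by simp
  have fin: "finite C'" "finite (C - {c})" using C' finite_code finite_C by auto
  have sub: "C - {c} \<subseteq> words F n" using code by auto
  show "energy n f (C - {c}) \<le> energy n f C'"
  proof (cases "3 \<le> card C")
    case True
    define E where "E = (\<Sum>i = 1..n. distance_distribution n C i * f i)"
    have E: "E = total_energy n f C / real (card C)"
      by (simp add: E_def total_energy_def distance_distribution_eq sum_divide_distrib)
    have "total_energy n f C = real (card C) * E" using E card_C_pos by simp
    then have "total_energy n f (C - {c}) = (real (card C) - 2) * E"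
      using total_energy_remove[OF finite_C c, of n f] codeword_energy[OF cm c]
      unfolding E[symmetric] by (simp add: algebra_simps)
    also have "\<dots> \<le> total_energy n f C'"
      unfolding E_def by (rule total_energy_le[OF cm C'(1) card True])
    finally show ?thesis
      unfolding energy_eq[OF fin(1) C'(1)] energy_eq[OF fin(2) sub] C'(2)[symmetric]
      by (rule divide_right_mono) simp
  next
    case False
    \<comment> \<open>Here both codes have at most one word. For the empty code the energy is
      \<open>0 / 0 = 0\<close>.\<close>
    have zero: "energy n f D = 0" if "finite D" "card D \<le> 1" for D :: "(nat \<Rightarrow> 'a) set"
    proof -
      have "{(x, y). x \<in> D \<and> y \<in> D \<and> x \<noteq> y} = {}"
        using that by (auto simp: card_le_Suc0_iff_eq)
      then show ?thesis by (simp only: energy_def) simp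
    qed
    show ?thesis using zero[OF fin(1)] zero[OF fin(2)] False card C' by simp
  qed
qed

end

theorem theorem1p1:
  fixes q n :: nat and F :: "'a set" and C :: "(nat \<Rightarrow> 'a) set"
  assumes "q \<ge> 2" and "n \<ge> 1"
    and "finite F" and "card F = q"
    and "C \<subseteq> words F n"
    and "lp_universally_optimal q n C"
  shows "distance_regular n C \<and> (\<forall>c\<in>C. universally_optimal F n (C - {c}))"
proof (cases "C = {}")
  case True
  \<comment> \<open>The empty code is treated apart because its distribution is 0 at distance 0 and
    so is no quasicode; both claims are vacuous for it.\<close>
  then show ?thesis by (simp add: distance_regular_def)
next
  case False
  then interpret lp_optimal_code F q n C
    using assms by unfold_locales
  show ?thesis using distance_regular_code universally_optimal_remove by blast
qed

end
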